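(* Let $G$ be a monoid, let $\mu,\chi:G\to\mathbb{C}$ be different nonzero multiplicative functions, let $A:G\to\mathbb{C}$ be an additive function such that $\chi A\neq 0$, and put $g:=\frac{\mu+\chi}{2}$. The solutions $f,g_1,h_1,h_2,h:G\to\mathbb{C}$ of the functional equation $$f(xy)=g_1(x)h_1(y)+g(x)h_2(y)+\chi(x)A(x)h(y)\quad\text{for all }x,y\in G$$ are exactly the quintuples $(f,g_1,h_1,h_2,h)$ of one of the following forms: (1) $f=0$, $g_1$ is arbitrary and $h_1=h_2=h=0$; (2) $f=0$, $g_1=a\frac{\mu+\chi}{2}+b\chi A$, $h_1\neq 0$ is arbitrary, $h_2=-ah_1$ and $h=-bh_1$, where $a,b\in\mathbb{C}$ are constants; (3) $f=(d_1-d_2)\left(\frac12 a_1\mu-\frac12 a_2\chi-\frac12 a_3\chi A\right)$, $g_1=\frac12 d_1\mu+\frac12 d_2\chi+d_3\chi A$, $h_1=a_1\mu+a_2\chi+a_3\chi A$, $h_2=-a_1d_2\mu-a_2d_1\chi-a_3d_1\chi A$ and $h=-a_1d_3\mu+\left(-a_2d_3-\frac12 a_3d_1+\frac12 a_3d_2\right)\chi-a_3d_3\chi A$, where $a_1,a_2,a_3,d_1,d_2,d_3\in\mathbb{C}$ are constants such that $d_1\neq d_2$ and $(a_1,a_2,a_3)\neq(0,0,0)$; (4) $f=a_1\alpha m$, $g_1=\alpha m-a_2\frac{\mu+\chi}{2}-a_3\chi A$, $h_1=a_1m$, $h_2=a_1a_2m$ and $h=a_1a_3m$, where $\alpha,a_1\in\mathbb{C}\setminus\{0\}$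 and $a_2,a_3\in\mathbb{C}$ are constants, and $m:G\to\mathbb{C}$ is a nonzero multiplicative function.
   Context: A function $A:G\to\mathbb{C}$ is additive if $A(xy)=A(x)+A(y)$ for all $x,y\in G$. A function $m:G\to\mathbb{C}$ is multiplicative if $m(xy)=m(x)m(y)$ for all $x,y\in G$; it is nonzero if it is not the zero function (it may take the value $0$). $\chi A$ denotes the pointwise product. "Arbitrary" means an arbitrary function $G\to\mathbb{C}$; $h_1\neq 0$ means that $h_1$ is not the zero function. *)

theory Defs
  imports Complex_Main
begin

definition additive_fun :: "('g::monoid_mult \<Rightarrow> complex) \<Rightarrow> bool" where
  "additive_fun A \<longleftrightarrow> (\<forall>x y. A (x * y) = A x + A y)"

(* The zero function satisfies this; non-vanishing is always a separate hypothesis. *)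
definition multiplicative_fun :: "('g::monoid_mult \<Rightarrow> complex) \<Rightarrow> bool" where
  "multiplicative_fun m \<longleftrightarrow> (\<forall>x y. m (x * y) = m x * m y)"

end

theory Submission
  imports Defs
begin

text \<open>
  The functions \<open>\<mu>\<close>, \<open>\<chi>\<close>, \<open>\<chi>A\<close> are linearly independent, and the right translates of any
  function in their span \<open>S\<close> are again in \<open>S\<close>, with explicit coefficients. Putting \<open>y = 1\<close> shows that
  \<open>f\<close> is a combination of \<open>g\<^sub>1\<close> and elements of \<open>S\<close>. If \<open>g\<^sub>1 \<in> S\<close>, the equation therefore lives in
  \<open>S\<close> and is solved by comparing coefficients in \<open>x\<close>. If \<open>g\<^sub>1 \<notin> S\<close> (and \<open>h\<^sub>1 \<noteq> 0\<close>), then \<open>h\<^sub>1 1 \<noteq> 0\<close>,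
  so \<open>g\<^sub>1\<close> can be eliminated from the expansion of \<open>f ((x y) z) = f (x (y z))\<close>; comparing the
  coefficients of \<open>g\<^sub>1, \<mu>, \<chi>\<close> in \<open>x\<close> makes \<open>h\<^sub>1\<close> proportional to a multiplicative function and
  \<open>h\<^sub>2\<close>, \<open>h\<close> proportional to \<open>h\<^sub>1\<close>.
\<close>

section \<open>Linear independence and comparison of coefficients\<close>

lemma multiplicative_fun_one:
  assumes "multiplicative_fun m" and "m \<noteq> (\<lambda>_. 0)"
  shows "m 1 = 1"
proof -
  obtain x where "m x \<noteq> 0" using assms(2) by auto
  moreover have "m x = m x * m 1"
    using assms(1) unfolding multiplicative_fun_def by (metis mult_1_right)
  ultimately show ?thesis by simp
qed

text \<open>That \<open>\<mu>\<close> and \<open>\<chi>\<close> do not vanish is recorded as the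
  value 1 at the identity, the form in which setting a variable to 1 uses it.\<close>

locale multiplicative_pair =
  fixes \<mu> \<chi> A :: "'g::monoid_mult \<Rightarrow> complex"
  assumes mu_mult: "\<mu> (x * y) = \<mu> x * \<mu> y"
    and chi_mult: "\<chi> (x * y) = \<chi> x * \<chi> y"
    and A_add: "A (x * y) = A x + A y"
    and mu_one: "\<mu> 1 = 1" and chi_one: "\<chi> 1 = 1"
    and mu_neq_chi: "\<mu> \<noteq> \<chi>"
    and chi_A_nonzero: "(\<lambda>x. \<chi> x * A x) \<noteq> (\<lambda>_. 0)"
begin

lemma A_one: "A 1 = 0"
  using A_add[of 1 1] by simp

definition in_span :: "('g \<Rightarrow> complex) \<Rightarrow> bool" where
  "in_span f \<longleftrightarrow> (\<exists>p q r. \<forall>x. f x = p * \<mu> x + q * \<chi> x + r * (\<chi> x * A x))"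

text \<open>Translating by \<open>y\<close> and subtracting \<open>\<chi> y\<close> times the
  relation removes \<open>q\<close>. Doing the same to the resulting relation removes
  \<open>r\<close> too and leaves \<open>p\<close> times the square of
  \<open>\<mu> y - \<chi> y\<close>.\<close>

lemma independent:
  assumes "\<And>x. p * \<mu> x + q * \<chi> x + r * (\<chi> x * A x) = 0"
  shows "p = 0" "q = 0" "r = 0"
proof -
  have step: "p * \<mu> x * (\<mu> y - \<chi> y) + r * \<chi> x * (\<chi> y * A y) = 0" for x y
  proof -
    have "p * \<mu> x * (\<mu> y - \<chi> y) + r * \<chi> x * (\<chi> y * A y)
        = (p * \<mu> (x * y) + q * \<chi> (x * y) + r * (\<chi> (x * y) * A (x * y)))
          - \<chi> y * (p * \<mu> x + q * \<chi> x + r * (\<chi> x * A x))"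
      by (simp add: mu_mult chi_mult A_add algebra_simps)
    then show ?thesis by (simp add: assms)
  qed
  obtain y where y: "\<mu> y \<noteq> \<chi> y" using mu_neq_chi by auto
  have "p * (\<mu> y - \<chi> y) * (\<mu> y - \<chi> y)
      = (p * \<mu> y * (\<mu> y - \<chi> y) + r * \<chi> y * (\<chi> y * A y))
        - \<chi> y * (p * \<mu> 1 * (\<mu> y - \<chi> y) + r * \<chi> 1 * (\<chi> y * A y))"
    by (simp add: mu_one chi_one algebra_simps)
  then show p: "p = 0" using y by (simp only: step) simp
  obtain z where "\<chi> z * A z \<noteq> 0" using chi_A_nonzero by (auto simp: fun_eq_iff)
  then show "r = 0" using step[of 1 z] by (simp add: p chi_one)
  show "q = 0" using assms[of 1] by (simp add: p chi_one A_one)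
qed

lemma independent_outside_span:
  assumes "\<not> in_span k"
    and zero: "\<And>x. s * k x + p * \<mu> x + q * \<chi> x + r * (\<chi> x * A x) = 0"
  shows "s = 0" "p = 0" "q = 0" "r = 0"
proof -
  show s: "s = 0"
  proof (rule ccontr)
    assume "s \<noteq> 0"
    have "k x = (- p / s) * \<mu> x + (- q / s) * \<chi> x + (- r / s) * (\<chi> x * A x)" for x
    proof -
      have "s * k x = - p * \<mu> x - q * \<chi> x - r * (\<chi> x * A x)"
        using zero[of x] by (simp add: algebra_simps add_eq_0_iff)
      then have "k x = (- p * \<mu> x - q * \<chi> x - r * (\<chi> x * A x)) / s"
        using \<open>s \<noteq> 0\<close> by (simp add: eq_divide_eq mult.commute)
      then show ?thesis by (simp add: diff_divide_distrib)
    qed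
    then show False using assms(1) unfolding in_span_def by blast
  qed
  show "p = 0" "q = 0" "r = 0"
    using independent[of p q r] zero by (simp_all add: s)
qed

text \<open>Setting \<open>y = 1\<close> puts \<open>f\<close> in the span with coefficients
  \<open>U 1\<close>, \<open>V 1\<close>, \<open>W 1\<close>. Expanding \<open>f (x * y)\<close>
  from this form and comparing with the hypothesis in \<open>x\<close> then determines
  \<open>U\<close>, \<open>V\<close>, \<open>W\<close> everywhere.\<close>

lemma coefficients:
  assumes eq: "\<And>x y. f (x * y) = \<mu> x * U y + \<chi> x * V y + \<chi> x * A x * W y"
  obtains p q r where "\<And>x. f x = p * \<mu> x + q * \<chi> x + r * (\<chi> x * A x)"
    and "\<And>y. U y = p * \<mu> y" and "\<And>y. V y = q * \<chi> y + r * (\<chi> y * A y)"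
    and "\<And>y. W y = r * \<chi> y"
proof -
  define p q r where "p = U 1" and "q = V 1" and "r = W 1"
  have f: "f x = p * \<mu> x + q * \<chi> x + r * (\<chi> x * A x)" for x
    using eq[of x 1] by (simp add: p_def q_def r_def algebra_simps)
  have zero: "(U y - p * \<mu> y) * \<mu> x + (V y - q * \<chi> y - r * (\<chi> y * A y)) * \<chi> x
      + (W y - r * \<chi> y) * (\<chi> x * A x) = 0" for x y
    using eq[of x y] f[of "x * y"] by (simp add: mu_mult chi_mult A_add algebra_simps)
  show thesis
  proof (rule that[of p q r])
    fix y
    show "U y = p * \<mu> y" "V y = q * \<chi> y + r * (\<chi> y * A y)" "W y = r * \<chi> y"
      using independent[OF zero[of y]] by (simp_all add: algebra_simps)
  qed (rule f)
qed

text \<open>Both \<open>\<mu> x\<close> and \<open>\<chi> x\<close> carry the coefficient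
  \<open>u y / 2\<close>, so \<open>p * \<mu>\<close> equals a combination of \<open>\<chi>\<close>
  and \<open>\<chi> A\<close>, which independence forbids unless all coefficients vanish.\<close>

lemma two_term_solution_zero:
  assumes "\<And>x y. f (x * y) = (\<mu> x + \<chi> x) / 2 * u y + \<chi> x * A x * v y"
  shows "f x = 0" "u x = 0" "v x = 0"
proof -
  have "f (x * y) = \<mu> x * (u y / 2) + \<chi> x * (u y / 2) + \<chi> x * A x * v y" for x y
    using assms[of x y] by (simp add: field_simps)
  then obtain p q r where pqr: "\<And>x. f x = p * \<mu> x + q * \<chi> x + r * (\<chi> x * A x)"
    "\<And>y. u y / 2 = p * \<mu> y" "\<And>y. u y / 2 = q * \<chi> y + r * (\<chi> y * A y)" "\<And>y. v y = r * \<chi> y"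
    by (rule coefficients) blast
  have "p * \<mu> y + (- q) * \<chi> y + (- r) * (\<chi> y * A y) = 0" for y
    using trans[OF sym[OF pqr(2)] pqr(3), of y] by simp
  from independent[OF this] have "p = 0" "q = 0" "r = 0" by simp_all
  then show "f x = 0" "u x = 0" "v x = 0"
    using pqr(1)[of x] pqr(2)[of x] pqr(4)[of x] by simp_all
qed

section \<open>Solutions according to the position of \<open>g1\<close> relative to the span\<close>

context
  fixes f g1 h1 h2 h :: "'g \<Rightarrow> complex"
  assumes eq: "\<And>x y. f (x * y) = g1 x * h1 y + (\<mu> x + \<chi> x) / 2 * h2 y + \<chi> x * A x * h y"
begin

lemma solution_first_zero:
  assumes "\<And>y. h1 y = 0"
  shows "f x = 0" "h2 x = 0" "h x = 0"
  using two_term_solution_zero[of f h2 h x] eq assms by simp_all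

text \<open>Such a \<open>g1\<close> is absorbed into the other two terms, which leaves a two-term
  equation.\<close>

lemma solution_degenerate:
  assumes g1: "\<And>x. g1 x = a * ((\<mu> x + \<chi> x) / 2) + b * (\<chi> x * A x)"
  shows "f x = 0" "h2 x = - a * h1 x" "h x = - b * h1 x"
proof -
  have "f (x * y) = (\<mu> x + \<chi> x) / 2 * (a * h1 y + h2 y) + \<chi> x * A x * (b * h1 y + h y)" for x y
    by (simp add: eq g1 field_simps)
  note * = two_term_solution_zero[OF this, of x]
  show "f x = 0" using *(1) .
  show "h2 x = - a * h1 x" "h x = - b * h1 x"
    using *(2,3) by (simp_all add: add_eq_0_iff)
qed

text \<open>Since \<open>d1\<close> and \<open>d2\<close> differ, the coefficients of
  \<open>\<mu> x\<close> and \<open>\<chi> x\<close> form an invertible linear system for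
  \<open>h1\<close> and \<open>h2\<close>; the coefficient of \<open>\<chi> x * A x\<close> then
  gives \<open>h\<close>.\<close>

lemma solution_in_span:
  assumes g1: "\<And>x. g1 x = 1/2 * d1 * \<mu> x + 1/2 * d2 * \<chi> x + d3 * (\<chi> x * A x)"
    and "d1 \<noteq> d2"
  obtains a1 a2 a3
  where "\<And>x. f x = (d1 - d2) * (1/2 * a1 * \<mu> x - 1/2 * a2 * \<chi> x - 1/2 * a3 * (\<chi> x * A x))"
    and "\<And>x. h1 x = a1 * \<mu> x + a2 * \<chi> x + a3 * (\<chi> x * A x)"
    and "\<And>x. h2 x = - a1 * d2 * \<mu> x - a2 * d1 * \<chi> x - a3 * d1 * (\<chi> x * A x)"
    and "\<And>x. h x = - a1 * d3 * \<mu> x + (- a2 * d3 - 1/2 * a3 * d1 + 1/2 * a3 * d2) * \<chi> x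
                  - a3 * d3 * (\<chi> x * A x)"
proof -
  have "f (x * y) = \<mu> x * ((d1 * h1 y + h2 y) / 2) + \<chi> x * ((d2 * h1 y + h2 y) / 2)
      + \<chi> x * A x * (d3 * h1 y + h y)" for x y
    by (simp add: eq g1 add_divide_distrib algebra_simps)
  then obtain p q r where f: "\<And>x. f x = p * \<mu> x + q * \<chi> x + r * (\<chi> x * A x)"
    and U: "\<And>y. (d1 * h1 y + h2 y) / 2 = p * \<mu> y"
    and V: "\<And>y. (d2 * h1 y + h2 y) / 2 = q * \<chi> y + r * (\<chi> y * A y)"
    and W: "\<And>y. d3 * h1 y + h y = r * \<chi> y"
    by (rule coefficients) blast
  \<comment> \<open>Subtracting \<open>V\<close> from \<open>U\<close> gives
    \<open>(d1 - d2) / 2 * h1\<close>, so these are the coefficients of \<open>h1\<close>.\<close>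
  define a1 a2 a3 where "a1 = 2 * p / (d1 - d2)" and "a2 = 2 * q / (d2 - d1)"
    and "a3 = 2 * r / (d2 - d1)"
  have pqr: "p = (d1 - d2) * a1 / 2" "q = (d2 - d1) * a2 / 2" "r = (d2 - d1) * a3 / 2"
    using \<open>d1 \<noteq> d2\<close> by (simp_all add: a1_def a2_def a3_def)
  have h1: "h1 x = a1 * \<mu> x + a2 * \<chi> x + a3 * (\<chi> x * A x)" for x
  proof -
    have "(d1 - d2) * h1 x = 2 * ((d1 * h1 x + h2 x) / 2 - (d2 * h1 x + h2 x) / 2)"
      by (simp add: field_simps)
    also have "\<dots> = (d1 - d2) * (a1 * \<mu> x + a2 * \<chi> x + a3 * (\<chi> x * A x))"
      unfolding U V pqr by (simp add: field_simps)
    finally show ?thesis using \<open>d1 \<noteq> d2\<close> by simp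
  qed
  have h2: "h2 x = - a1 * d2 * \<mu> x - a2 * d1 * \<chi> x - a3 * d1 * (\<chi> x * A x)" for x
  proof -
    have "h2 x = 2 * ((d1 * h1 x + h2 x) / 2) - d1 * h1 x" by (simp add: field_simps)
    also have "\<dots> = - a1 * d2 * \<mu> x - a2 * d1 * \<chi> x - a3 * d1 * (\<chi> x * A x)"
      unfolding U unfolding pqr h1 by (simp add: field_simps)
    finally show ?thesis .
  qed
  have h: "h x = - a1 * d3 * \<mu> x + (- a2 * d3 - 1/2 * a3 * d1 + 1/2 * a3 * d2) * \<chi> x
                  - a3 * d3 * (\<chi> x * A x)" for x
  proof -
    have "h x = (d3 * h1 x + h x) - d3 * h1 x" by simp
    also have "\<dots> = - a1 * d3 * \<mu> x + (- a2 * d3 - 1/2 * a3 * d1 + 1/2 * a3 * d2) * \<chi> x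
                  - a3 * d3 * (\<chi> x * A x)"
      unfolding W unfolding pqr h1 by (simp add: field_simps)
    finally show ?thesis .
  qed
  show thesis
    by (rule that[OF _ h1 h2 h]) (simp add: f pqr field_simps)
qed

lemma solution_outside_span:
  assumes g1: "\<not> in_span g1" and "h1 \<noteq> (\<lambda>_. 0)"
  obtains \<alpha> a1 a2 a3 m
  where "\<alpha> \<noteq> 0" "a1 \<noteq> 0" "multiplicative_fun m" "m \<noteq> (\<lambda>_. 0)"
    and "\<And>x. f x = a1 * \<alpha> * m x"
    and "\<And>x. g1 x = \<alpha> * m x - a2 * ((\<mu> x + \<chi> x) / 2) - a3 * (\<chi> x * A x)"
    and "\<And>x. h1 x = a1 * m x" and "\<And>x. h2 x = a1 * a2 * m x" and "\<And>x. h x = a1 * a3 * m x"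
proof -
  define c1 c2 c3 where "c1 = h1 1" and "c2 = h2 1" and "c3 = h 1"
  have f: "f x = c1 * g1 x + c2 * ((\<mu> x + \<chi> x) / 2) + c3 * (\<chi> x * A x)" for x
    using eq[of x 1] by (simp add: c1_def c2_def c3_def algebra_simps)
  \<comment> \<open>With \<open>c1 = 0\<close> the function \<open>f\<close> lies in the span, and
    the coefficient \<open>h1 y\<close> of \<open>g1\<close> would have to vanish for every
    \<open>y\<close>.\<close>
  have c1: "c1 \<noteq> 0"
  proof
    assume "c1 = 0"
    obtain y where y: "h1 y \<noteq> 0" using assms(2) by auto
    have "h1 y * g1 x + ((h2 y - c2 * \<mu> y) / 2) * \<mu> x
        + ((h2 y - c2 * \<chi> y) / 2 - c3 * (\<chi> y * A y)) * \<chi> x + (h y - c3 * \<chi> y) * (\<chi> x * A x) = 0" for x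
      using eq[of x y] f[of "x * y"] \<open>c1 = 0\<close>
      by (simp add: mu_mult chi_mult A_add field_simps)
    from independent_outside_span(1)[OF g1 this] y show False by simp
  qed
  \<comment> \<open>These measure how far \<open>h2\<close> and \<open>h\<close> are from being
    \<open>c2 / c1\<close> and \<open>c3 / c1\<close> times \<open>h1\<close>. They arise when
    \<open>g1 (x * y)\<close> is eliminated.\<close>
  define P Q where "P z = c1 * h2 z - c2 * h1 z" and "Q z = c1 * h z - c3 * h1 z" for z
  \<comment> \<open>This is \<open>c1\<close> times the difference of the two expansions of
    \<open>f (x * y * z)\<close>, where \<open>c1 * g1 (x * y)\<close> is replaced by
    \<open>?R\<close>.\<close>
  have assoc: "(h1 y * h1 z - c1 * h1 (y * z)) * g1 x
      + ((h1 z * h2 y + \<mu> y * P z - c1 * h2 (y * z)) / 2) * \<mu> x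
      + ((h1 z * h2 y + \<chi> y * P z - c1 * h2 (y * z)) / 2 + \<chi> y * A y * Q z) * \<chi> x
      + (h1 z * h y + \<chi> y * Q z - c1 * h (y * z)) * (\<chi> x * A x) = 0" (is "?L = 0") for x y z
  proof -
    let ?R = "g1 x * h1 y + (\<mu> x + \<chi> x) / 2 * h2 y + \<chi> x * A x * h y
        - c2 * ((\<mu> (x * y) + \<chi> (x * y)) / 2) - c3 * (\<chi> (x * y) * A (x * y))"
    let ?S = "(\<mu> (x * y) + \<chi> (x * y)) / 2 * h2 z + \<chi> (x * y) * A (x * y) * h z"
    let ?T = "g1 x * h1 (y * z) + (\<mu> x + \<chi> x) / 2 * h2 (y * z) + \<chi> x * A x * h (y * z)"
    have R: "?R = c1 * g1 (x * y)"
      using f[of "x * y"] eq[of x y] by (simp add: algebra_simps)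
    have S: "?S = ?T - g1 (x * y) * h1 z"
      using eq[of "x * y" z] eq[of x "y * z"] by (simp add: mult.assoc algebra_simps)
    have "?L = ?R * h1 z + c1 * ?S - c1 * ?T"
      by (simp add: P_def Q_def mu_mult chi_mult A_add field_simps)
    also have "\<dots> = 0"
      unfolding R S by (simp add: algebra_simps)
    finally show ?thesis .
  qed
  note coeff = independent_outside_span[OF g1 assoc]
  have h1_mult: "h1 y * h1 z = c1 * h1 (y * z)" for y z
    using coeff(1)[of y z] by simp
  \<comment> \<open>The coefficients of \<open>\<mu> x\<close> and \<open>\<chi> x\<close> share the
    terms in \<open>h2\<close>; their difference is a linear relation in \<open>y\<close> with
    coefficients built from \<open>P z\<close> and \<open>Q z\<close>.\<close>
  have PQ: "P z = 0 \<and> Q z = 0" for z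
  proof -
    have "(P z / 2) * \<mu> y + (- P z / 2) * \<chi> y + (- Q z) * (\<chi> y * A y) = 0" for y
    proof -
      have "(P z / 2) * \<mu> y + (- P z / 2) * \<chi> y + (- Q z) * (\<chi> y * A y)
          = (h1 z * h2 y + \<mu> y * P z - c1 * h2 (y * z)) / 2
            - ((h1 z * h2 y + \<chi> y * P z - c1 * h2 (y * z)) / 2 + \<chi> y * A y * Q z)"
        by (simp add: field_simps)
      then show ?thesis by (simp only: coeff(2,3)) simp
    qed
    from independent(1,3)[OF this] show ?thesis by simp
  qed
  define m where "m x = h1 x / c1" for x
  have h1: "h1 x = c1 * m x" for x
    using c1 by (simp add: m_def)
  have h2: "h2 x = c2 * m x" and h: "h x = c3 * m x" for x
    using PQ[of x] c1 by (simp_all add: P_def Q_def m_def field_simps)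
  have "multiplicative_fun m"
    unfolding multiplicative_fun_def m_def using h1_mult c1 by (simp add: field_simps)
  define \<phi> where "\<phi> = f 1"
  \<comment> \<open>At first argument 1 the term with \<open>h\<close> drops out, as
    \<open>A 1 = 0\<close>, leaving the factor \<open>c1 * g1 1 + c2 = f 1\<close>.\<close>
  have f_m: "f x = \<phi> * m x" for x
    using eq[of 1 x] f[of 1]
    by (simp add: \<phi>_def h1 h2 h mu_one chi_one A_one algebra_simps)
  have g1_m: "g1 x = \<phi> / c1 * m x - c2 / c1 * ((\<mu> x + \<chi> x) / 2) - c3 / c1 * (\<chi> x * A x)" for x
    using f[of x] f_m[of x] c1 by (simp add: field_simps)
  \<comment> \<open>Otherwise \<open>f = 0\<close>, and dividing by \<open>c1\<close> would put
    \<open>g1\<close> in the span.\<close>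
  have "\<phi> \<noteq> 0"
  proof
    assume "\<phi> = 0"
    then have "c1 * g1 x + (c2 / 2) * \<mu> x + (c2 / 2) * \<chi> x + c3 * (\<chi> x * A x) = 0" for x
      using f[of x] f_m[of x] by (simp add: field_simps)
    from independent_outside_span(1)[OF g1 this] c1 show False by simp
  qed
  show thesis
  proof (rule that[of "\<phi> / c1" c1 m "c2 / c1" "c3 / c1"])
    show "m \<noteq> (\<lambda>_. 0)" using assms(2) h1 by auto
  qed (use c1 \<open>\<phi> \<noteq> 0\<close> \<open>multiplicative_fun m\<close> f_m g1_m h1 h2 h in simp_all)
qed

end

end

section \<open>Assembly of the equivalence\<close>

theorem theorem6p3:
  fixes \<mu> \<chi> A g :: "'g::monoid_mult \<Rightarrow> complex"
    and f g1 h1 h2 h :: "'g \<Rightarrow> complex"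
  assumes "multiplicative_fun \<mu>" and "\<mu> \<noteq> (\<lambda>_. 0)"
    and "multiplicative_fun \<chi>" and "\<chi> \<noteq> (\<lambda>_. 0)"
    and "\<mu> \<noteq> \<chi>"
    and "additive_fun A" and "(\<lambda>x. \<chi> x * A x) \<noteq> (\<lambda>_. 0)"
    and "g = (\<lambda>x. (\<mu> x + \<chi> x) / 2)"
  shows "(\<forall>x y. f (x * y) = g1 x * h1 y + g x * h2 y + \<chi> x * A x * h y) \<longleftrightarrow>
    (f = (\<lambda>_. 0) \<and> h1 = (\<lambda>_. 0) \<and> h2 = (\<lambda>_. 0) \<and> h = (\<lambda>_. 0))
  \<or> (\<exists>a b :: complex.
        f = (\<lambda>_. 0)
      \<and> g1 = (\<lambda>x. a * ((\<mu> x + \<chi> x) / 2) + b * (\<chi> x * A x))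
      \<and> h1 \<noteq> (\<lambda>_. 0)
      \<and> h2 = (\<lambda>x. - a * h1 x)
      \<and> h = (\<lambda>x. - b * h1 x))
  \<or> (\<exists>a1 a2 a3 d1 d2 d3 :: complex.
        d1 \<noteq> d2 \<and> (a1, a2, a3) \<noteq> (0, 0, 0)
      \<and> f = (\<lambda>x. (d1 - d2) * (1/2 * a1 * \<mu> x - 1/2 * a2 * \<chi> x - 1/2 * a3 * (\<chi> x * A x)))
      \<and> g1 = (\<lambda>x. 1/2 * d1 * \<mu> x + 1/2 * d2 * \<chi> x + d3 * (\<chi> x * A x))
      \<and> h1 = (\<lambda>x. a1 * \<mu> x + a2 * \<chi> x + a3 * (\<chi> x * A x))
      \<and> h2 = (\<lambda>x. - a1 * d2 * \<mu> x - a2 * d1 * \<chi> x - a3 * d1 * (\<chi> x * A x))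
      \<and> h = (\<lambda>x. - a1 * d3 * \<mu> x + (- a2 * d3 - 1/2 * a3 * d1 + 1/2 * a3 * d2) * \<chi> x
                  - a3 * d3 * (\<chi> x * A x)))
  \<or> (\<exists>(\<alpha> :: complex) (a1 :: complex) (a2 :: complex) (a3 :: complex) (m :: 'g \<Rightarrow> complex).
        \<alpha> \<noteq> 0 \<and> a1 \<noteq> 0 \<and> multiplicative_fun m \<and> m \<noteq> (\<lambda>_. 0)
      \<and> f = (\<lambda>x. a1 * \<alpha> * m x)
      \<and> g1 = (\<lambda>x. \<alpha> * m x - a2 * ((\<mu> x + \<chi> x) / 2) - a3 * (\<chi> x * A x))
      \<and> h1 = (\<lambda>x. a1 * m x)
      \<and> h2 = (\<lambda>x. a1 * a2 * m x)
      \<and> h = (\<lambda>x. a1 * a3 * m x))"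
proof -
  interpret multiplicative_pair \<mu> \<chi> A
    using assms by unfold_locales (auto simp: multiplicative_fun_def additive_fun_def
        intro: multiplicative_fun_one)
  show ?thesis (is "?eq \<longleftrightarrow> ?one \<or> ?two \<or> ?three \<or> ?four")
  proof
    assume ?eq
    then have eq: "f (x * y) = g1 x * h1 y + (\<mu> x + \<chi> x) / 2 * h2 y + \<chi> x * A x * h y" for x y
      using assms(8) by simp
    consider "h1 = (\<lambda>_. 0)" | "h1 \<noteq> (\<lambda>_. 0)" "in_span g1" | "h1 \<noteq> (\<lambda>_. 0)" "\<not> in_span g1"
      by blast
    then show "?one \<or> ?two \<or> ?three \<or> ?four"
    proof cases
      case 1
      then have ?one using solution_first_zero[OF eq] by (simp add: fun_eq_iff)
      then show ?thesis by (rule disjI1)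
    next
      case 2
      then obtain p q r where pqr: "\<And>x. g1 x = p * \<mu> x + q * \<chi> x + r * (\<chi> x * A x)"
        unfolding in_span_def by blast
      show ?thesis
      \<comment> \<open>Equality means that \<open>g1\<close> is already a combination of
        \<open>g\<close> and \<open>\<chi> A\<close>. The factors 2 below compensate for the halves
        in \<open>g\<close> and in the third form.\<close>
      proof (cases "p = q")
        case True
        have g1: "g1 x = (2 * p) * ((\<mu> x + \<chi> x) / 2) + r * (\<chi> x * A x)" for x
          using pqr[of x] True by (simp add: algebra_simps)
        have ?two
          by (rule exI[of _ "2 * p"], rule exI[of _ r])
            (intro conjI ext 2(1) g1 solution_degenerate[OF eq g1])
        then show ?thesis by (intro disjI2[OF disjI1])
      next
        case False
        have g1: "g1 x = 1/2 * (2 * p) * \<mu> x + 1/2 * (2 * q) * \<chi> x + r * (\<chi> x * A x)" for x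
          using pqr[of x] by simp
        obtain a1 a2 a3 where sol:
          "\<And>x. f x = (2 * p - 2 * q) * (1/2 * a1 * \<mu> x - 1/2 * a2 * \<chi> x - 1/2 * a3 * (\<chi> x * A x))"
          "\<And>x. h1 x = a1 * \<mu> x + a2 * \<chi> x + a3 * (\<chi> x * A x)"
          "\<And>x. h2 x = - a1 * (2 * q) * \<mu> x - a2 * (2 * p) * \<chi> x - a3 * (2 * p) * (\<chi> x * A x)"
          "\<And>x. h x = - a1 * r * \<mu> x + (- a2 * r - 1/2 * a3 * (2 * p) + 1/2 * a3 * (2 * q)) * \<chi> x
              - a3 * r * (\<chi> x * A x)"
          using solution_in_span[OF eq g1] False by auto
        have "(a1, a2, a3) \<noteq> (0, 0, 0)"
          using 2(1) sol(2) by auto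
        then have ?three
          using False
          by - (rule exI[of _ a1], rule exI[of _ a2], rule exI[of _ a3], rule exI[of _ "2 * p"],
              rule exI[of _ "2 * q"], rule exI[of _ r], intro conjI ext g1 sol, simp_all)
        then show ?thesis by (intro disjI2[OF disjI2[OF disjI1]])
      qed
    next
      case 3
      obtain \<alpha> a1 a2 a3 m where sol:
        "\<alpha> \<noteq> 0" "a1 \<noteq> 0" "multiplicative_fun m" "m \<noteq> (\<lambda>_. 0)"
        "\<And>x. f x = a1 * \<alpha> * m x"
        "\<And>x. g1 x = \<alpha> * m x - a2 * ((\<mu> x + \<chi> x) / 2) - a3 * (\<chi> x * A x)"
        "\<And>x. h1 x = a1 * m x" "\<And>x. h2 x = a1 * a2 * m x" "\<And>x. h x = a1 * a3 * m x"
        by (rule solution_outside_span[OF eq 3(2,1)]) (rule that)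
      have ?four
        by (rule exI[of _ \<alpha>], rule exI[of _ a1], rule exI[of _ a2], rule exI[of _ a3],
            rule exI[of _ m]) (intro conjI ext sol)
      then show ?thesis by (intro disjI2)
    qed
  next
    assume "?one \<or> ?two \<or> ?three \<or> ?four"
    then show ?eq
    proof (elim disjE)
      assume ?one
      then show ?eq by simp
    next
      assume ?two
      then show ?eq unfolding assms(8) by (elim exE conjE) (simp add: field_simps)
    next
      assume ?three
      then show ?eq unfolding assms(8)
        by (elim exE conjE) (simp add: mu_mult chi_mult A_add field_simps)
    next
      assume ?four
      then show ?eq unfolding assms(8)
        by (elim exE conjE) (simp add: multiplicative_fun_def field_simps)
    qed
  qed
qed

end
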